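(* Let $\mathcal{X}$ and $\mathcal{Y}$ be finite sets with $|\mathcal{X}| \ge 2$ and $|\mathcal{Y}| \ge 2$, let $0 < \epsilon < 1$ and $0 < \delta < 1/2$. Then for every positive integer $n$ there exist a probability mass function $p$ on $\mathcal{X}$ and a transition function $w$ from $\mathcal{X}$ to $\mathcal{Y}$ such that: (1) $I(p,w) > \epsilon$; (2) if $S$ is a training set of $n$ i.i.d. pairs with distribution $p \times w$, and a plug-in algorithm (any one) returns the decoding metric $K$ for the input $S$, then $$\Pr[\, I_{\mathrm{LM}}(p,w,K) = 0 \,] > \delta .$$
   Context: A transition function $w$ from $\mathcal{X}$ to $\mathcal{Y}$ assigns to each $x \in \mathcal{X}$ a probability mass function (PMF) $w(\cdot|x)$ on $\mathcal{Y}$. For a PMF $p$ on $\mathcal{X}$, $pw$ is the PMF on $\mathcal{Y}$ given by $pw(y) = \sum_{x} p(x) w(y|x)$; $p \times w$ is the PMF on $\mathcal{X}\times\mathcal{Y}$ given by $(p\times w)(x,y) = p(x)w(y|x)$; $I(p,w)$ is the mutual information, in bits, between $X$ and $Y$ when $(X,Y)\sim p\times w$. A decoding metric is a function $k : \mathcal{X}\times\mathcal{Y}\to[0,\infty)$. The LM rate is $$I_{\mathrm{LM}}(p,w,k) = \min_{\tilde w \in \tilde W(p,w)} I(p,\tilde w),$$ where $\tilde W(p,w)$ is the set of transition functions $\tilde w$ from $\mathcal{X}$ to $\mathcal{Y}$ with $p\tilde w = pw$ and $$E_{(X,Y)\sim p\times\tilde w}\log_2 k(X,Y) \ge E_{(X,Y)\sim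 p\times w}\log_2 k(X,Y),$$ with the conventions $\log_2 0 = -\infty$ and $0\cdot(-\infty)=0$ (so expectations take values in $[-\infty,\infty)$). A training set of size $n$ is a sequence $s\in(\mathcal{X}\times\mathcal{Y})^n$; $N(x,y|s)$ denotes the number of occurrences of the pair $(x,y)$ in $s$. A plug-in algorithm is a (deterministic) mapping that, for every positive integer $n$ and every $s\in(\mathcal{X}\times\mathcal{Y})^n$, returns a decoding metric $k:\mathcal{X}\times\mathcal{Y}\to[0,\infty)$ for which there exists a PMF $p_s$ on $\mathcal{X}$ with $N(x,y|s) = n\,p_s(x)\,k(x,y)$ for all $x\in\mathcal{X}$, $y\in\mathcal{Y}$. The pair $(p,w)$ does not depend on which plug-in algorithm is used. *)

theory Defs
  imports "HOL-Probability.Probability"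
begin

text \<open>
  A transition function from \<open>'x\<close> to \<open>'y\<close> has type \<open>'x \<Rightarrow> 'y pmf\<close>, with \<open>pmf (w x) y\<close> the
  probability \<open>w(y|x)\<close>. The output distribution \<open>pw\<close> is \<open>bind_pmf p w\<close>.
\<close>

definition joint_pmf :: "'x pmf \<Rightarrow> ('x \<Rightarrow> 'y pmf) \<Rightarrow> ('x \<times> 'y) pmf" where
  "joint_pmf p w = do {x \<leftarrow> p; y \<leftarrow> w x; return_pmf (x, y)}"

lemma pmf_joint_pmf: "pmf (joint_pmf p w) (x, y) = pmf p x * pmf (w x) y"
proof -
  have "joint_pmf p w = bind_pmf p (\<lambda>x'. map_pmf (Pair x') (w x'))"
    by (simp add: joint_pmf_def map_pmf_def)
  moreover have "pmf (map_pmf (Pair x') (w x')) (x, y) = indicator {x} x' * pmf (w x) y" for x'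
  proof (cases "x' = x")
    case True
    then show ?thesis by (simp add: pmf_map_inj' inj_def)
  next
    case False
    then have "(x, y) \<notin> set_pmf (map_pmf (Pair x') (w x'))" by auto
    then have "pmf (map_pmf (Pair x') (w x')) (x, y) = 0"
      by (simp only: set_pmf_iff not_not)
    then show ?thesis using False by simp
  qed
  ultimately show ?thesis
    by (simp add: pmf_bind measure_pmf_single)
qed

lemma pmf_output:
  fixes p :: "'x::finite pmf"
  shows "pmf (bind_pmf p w) y = (\<Sum>x\<in>UNIV. pmf p x * pmf (w x) y)"
  by (simp add: pmf_bind integral_measure_pmf_real[where A = UNIV] mult.commute)

definition mutual_info :: "'x pmf \<Rightarrow> ('x \<Rightarrow> 'y pmf) \<Rightarrow> real" where
  "mutual_info p w = prob_space.mutual_information (measure_pmf (joint_pmf p w)) 2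
     (count_space UNIV) (count_space UNIV) fst snd"

lemma mutual_info_eq_sum:
  fixes p :: "'x::finite pmf" and w :: "'x \<Rightarrow> 'y::finite pmf"
  shows "mutual_info p w =
    (\<Sum>(x, y)\<in>UNIV. pmf p x * pmf (w x) y * log 2 (pmf (w x) y / pmf (bind_pmf p w) y))"
proof -
  interpret information_space "measure_pmf (joint_pmf p w)" 2 by standard auto
  have d: "measure_pmf q = density (count_space UNIV) (\<lambda>x. ennreal (pmf q x))" for q :: "'a pmf"
    by (rule measure_pmf_eq_density)
  have f: "map_pmf fst (joint_pmf p w) = p" "map_pmf snd (joint_pmf p w) = bind_pmf p w"
    by (simp_all add: joint_pmf_def map_bind_pmf bind_return_pmf')
  have X: "distributed (measure_pmf (joint_pmf p w)) (count_space UNIV) fst (\<lambda>x. ennreal (pmf p x))"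
    unfolding distributed_def using f by (simp add: map_pmf_rep_eq[symmetric] d[symmetric])
  have Y: "distributed (measure_pmf (joint_pmf p w)) (count_space UNIV) snd (\<lambda>y. ennreal (pmf (bind_pmf p w) y))"
    unfolding distributed_def using f by (simp add: map_pmf_rep_eq[symmetric] d[symmetric])
  have c: "count_space (UNIV::'x set) \<Otimes>\<^sub>M count_space (UNIV::'y set) = count_space UNIV"
    by (simp add: pair_measure_count_space)
  have XY: "distributed (measure_pmf (joint_pmf p w)) (count_space UNIV \<Otimes>\<^sub>M count_space UNIV) (\<lambda>x. (fst x, snd x)) (\<lambda>z. ennreal (pmf (joint_pmf p w) z))"
    unfolding distributed_def c by (simp add: d[symmetric] distr_id2)
  have pj: "pmf (joint_pmf p w) z = pmf p (fst z) * pmf (w (fst z)) (snd z)" for z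
    by (cases z) (simp add: pmf_joint_pmf)
  show ?thesis
    unfolding mutual_info_def
    by (subst mutual_information_distr[OF _ _ X _ Y _ XY])
      (auto simp: c sigma_finite_measure_count_space_finite lebesgue_integral_count_space_finite
        pj case_prod_unfold intro!: sum.cong)
qed

text \<open>
  Since \<open>0 * (-\<infinity>) = 0\<close> holds in \<^typ>\<open>ereal\<close> and no term below is \<open>\<infinity>\<close>, the sum is the
  expectation of \<open>log\<^sub>2 k(X,Y)\<close> under the conventions \<open>log\<^sub>2 0 = -\<infinity>\<close> and \<open>0 * (-\<infinity>) = 0\<close>.
\<close>

definition elog2 :: "real \<Rightarrow> ereal" where
  "elog2 t = (if t = 0 then - \<infinity> else ereal (log 2 t))"

definition expected_log_metric ::
    "('x::finite \<times> 'y::finite) pmf \<Rightarrow> ('x \<Rightarrow> 'y \<Rightarrow> real) \<Rightarrow> ereal" where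
  "expected_log_metric q k = (\<Sum>(x, y)\<in>UNIV. ereal (pmf q (x, y)) * elog2 (k x y))"

definition lm_feasible ::
    "'x::finite pmf \<Rightarrow> ('x \<Rightarrow> 'y::finite pmf) \<Rightarrow> ('x \<Rightarrow> 'y \<Rightarrow> real) \<Rightarrow> ('x \<Rightarrow> 'y pmf) set" where
  "lm_feasible p w k = {w'. bind_pmf p w' = bind_pmf p w \<and>
     expected_log_metric (joint_pmf p w') k \<ge> expected_log_metric (joint_pmf p w) k}"

text \<open>
  \<open>LEAST\<close> on the reals denotes the minimum. It exists for every nonnegative \<open>k\<close>: mutual information
  is continuous in the transition function, and the feasible set is nonempty and compact.
\<close>

definition lm_rate ::
    "'x::finite pmf \<Rightarrow> ('x \<Rightarrow> 'y::finite pmf) \<Rightarrow> ('x \<Rightarrow> 'y \<Rightarrow> real) \<Rightarrow> real" where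
  "lm_rate p w k = (LEAST r. r \<in> mutual_info p ` lm_feasible p w k)"

text \<open>
  The size \<open>n\<close> of a training set is the length of the list. The PMF \<open>p\<^sub>s\<close> is not required to be the
  empirical one, so row \<open>x\<close> of the metric is unconstrained where \<open>p\<^sub>s(x) = 0\<close>. Nothing is required
  of the metric returned for the empty list.
\<close>

definition plug_in_algorithm :: "(('x \<times> 'y) list \<Rightarrow> 'x \<Rightarrow> 'y \<Rightarrow> real) \<Rightarrow> bool" where
  "plug_in_algorithm A \<longleftrightarrow> (\<forall>n>0. \<forall>s. length s = n \<longrightarrow>
     (\<forall>x y. A s x y \<ge> 0) \<and>
     (\<exists>ps :: 'x pmf. \<forall>x y. real (count_list s (x, y)) = real n * pmf ps x * A s x y))"

end

theory Submission
  imports Defs "HOL-Real_Asymp.Real_Asymp"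
begin

text \<open>
  Take \<open>p\<close> uniform on two letters and \<open>w\<close> a binary symmetric channel with tiny crossover
  probability \<open>\<eta>\<close>. Its mutual information tends to one bit as \<open>\<eta> \<rightarrow> 0\<close>, while with probability at
  least \<open>(1 - \<eta>)^n\<close> no crossover occurs in the training set. In that case the metric vanishes at a
  crossover pair of positive probability whose input letter was observed, so the expected log metric of the true channel is \<open>-\<infinity>\<close>.
  Every channel with the right output distribution is then feasible, in particular the constant one.
\<close>

lemma mutual_info_const:
  fixes p :: "'x::finite pmf" and q :: "'y::finite pmf"
  shows "mutual_info p (\<lambda>_. q) = 0"
  by (auto simp: mutual_info_eq_sum intro!: sum.neutral)

text \<open>Gibbs' inequality term by term: \<open>ln t \<le> t - 1\<close>, with \<open>t\<close>
  the ratio of \<open>pmf ?q y\<close> to \<open>pmf (w x) y\<close>, bounds each summand below by a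
  difference of two joint probabilities over \<open>ln 2\<close>. Both families sum to 1, so the
  bounds sum to 0.\<close>

lemma mutual_info_nonneg:
  fixes p :: "'x::finite pmf" and w :: "'x \<Rightarrow> 'y::finite pmf"
  shows "mutual_info p w \<ge> 0"
proof -
  let ?q = "bind_pmf p w"
  have le: "(pmf p x * pmf (w x) y - pmf p x * pmf ?q y) / ln 2
      \<le> pmf p x * pmf (w x) y * log 2 (pmf (w x) y / pmf ?q y)" for x y
  proof (cases "pmf p x * pmf (w x) y = 0")
    case True
    then show ?thesis by (auto simp: divide_simps)
  next
    case False
    then have pos: "pmf p x > 0" "pmf (w x) y > 0"
      by (auto simp: pmf_nonneg less_le)
    then have "y \<in> set_pmf ?q"
      by (auto simp: pmf_positive_iff)
    then have q: "pmf ?q y > 0" by (simp add: pmf_positive_iff)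
    have "ln (pmf ?q y / pmf (w x) y) \<le> pmf ?q y / pmf (w x) y - 1"
      using pos q by (intro ln_le_minus_one) simp
    then have "1 - pmf ?q y / pmf (w x) y \<le> ln (pmf (w x) y / pmf ?q y)"
      using pos q by (simp add: ln_div)
    then have "pmf p x * pmf (w x) y * (1 - pmf ?q y / pmf (w x) y)
        \<le> pmf p x * pmf (w x) y * ln (pmf (w x) y / pmf ?q y)"
      using pos by (intro mult_left_mono) auto
    then show ?thesis
      using pos by (simp add: log_def divide_right_mono algebra_simps)
  qed
  have "(\<Sum>(x, y)\<in>UNIV. pmf p x * pmf r y) = 1" for r :: "'y pmf"
    using sum_pmf_eq_1[of UNIV "pair_pmf p r"] by (simp add: case_prod_unfold flip: pmf_pair)
  moreover have "(\<Sum>(x, y)\<in>UNIV. pmf p x * pmf (w x) y) = 1"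
    using sum_pmf_eq_1[of UNIV "joint_pmf p w"]
    by (simp add: case_prod_unfold flip: pmf_joint_pmf)
  ultimately have "0 = (\<Sum>(x, y)\<in>UNIV. (pmf p x * pmf (w x) y - pmf p x * pmf ?q y) / ln 2)"
    by (simp add: case_prod_unfold sum_subtractf flip: sum_divide_distrib)
  also have "\<dots> \<le> mutual_info p w"
    unfolding mutual_info_eq_sum using le by (intro sum_mono) auto
  finally show ?thesis .
qed

text \<open>In \<open>ereal\<close> a sum containing \<open>\<infinity>\<close> is
  \<open>\<infinity>\<close> even next to \<open>-\<infinity>\<close>, so the other terms must be
  shown to differ from \<open>\<infinity>\<close> before the single infinite term can decide the
  sum.\<close>

lemma expected_log_metric_eq_MInf:
  assumes "(x, y) \<in> set_pmf q" and "k x y = 0"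
  shows "expected_log_metric q k = - \<infinity>"
proof -
  let ?f = "\<lambda>(x, y). ereal (pmf q (x, y)) * elog2 (k x y)"
  have "?f z \<noteq> \<infinity>" for z
    by (cases z) (auto simp: elog2_def)
  then have "sum ?f (UNIV - {(x, y)}) \<noteq> \<infinity>"
    by (simp add: sum_Pinfty)
  moreover have "?f (x, y) = - \<infinity>"
    using assms by (simp add: elog2_def set_pmf_iff pmf_nonneg less_le)
  ultimately show ?thesis
    unfolding expected_log_metric_def by (simp add: sum.remove[of UNIV "(x, y)"])
qed

text \<open>The true channel has expectation \<open>-\<infinity>\<close>, so the metric constraint
  is vacuous. The constant channel attains 0, and nonnegativity makes this the least value.\<close>

lemma lm_rate_eq_0:
  assumes "(x, y) \<in> set_pmf (joint_pmf p w)" and "k x y = 0"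
  shows "lm_rate p w k = 0"
  unfolding lm_rate_def
proof (rule Least_equality)
  have "(\<lambda>_. bind_pmf p w) \<in> lm_feasible p w k"
    by (simp add: lm_feasible_def expected_log_metric_eq_MInf[OF assms(1), of k, OF assms(2)])
  then show "0 \<in> mutual_info p ` lm_feasible p w k"
    by (force simp: mutual_info_const)
qed (auto simp: mutual_info_nonneg)

text \<open>Observing \<open>x\<close> at all forces \<open>ps x\<close> to be nonzero; a zero count
  in the same row can then only come from the metric.\<close>

lemma plug_in_algorithm_zero:
  assumes "plug_in_algorithm A" and "(x, y) \<in> set s" and "(x, y') \<notin> set s"
  shows "A s x y' = 0"
proof -
  have n: "length s > 0" using assms(2) by (cases s) auto
  then obtain ps :: "'a pmf" where
    ps: "\<And>x y. real (count_list s (x, y)) = real (length s) * pmf ps x * A s x y"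
    using assms(1) unfolding plug_in_algorithm_def by blast
  have "count_list s (x, y) \<noteq> 0" using assms(2) by (simp add: count_list_0_iff)
  then have "pmf ps x \<noteq> 0" using ps[of x y] by auto
  moreover have "real (count_list s (x, y')) = 0" using assms(3) by (simp add: count_list_0_iff)
  ultimately show ?thesis using ps[of x y'] n by auto
qed

lemma prob_replicate_pmf_lists:
  assumes "countable B"
  shows "measure_pmf.prob (replicate_pmf n q) (lists B) = measure_pmf.prob q B ^ n"
proof (induction n)
  case (Suc n)
  have "replicate_pmf (Suc n) q = map_pmf (\<lambda>(x, xs). x # xs) (pair_pmf q (replicate_pmf n q))"
    by (simp add: pair_pmf_def map_bind_pmf)
  moreover have "(\<lambda>(x, xs). x # xs) -` lists B = B \<times> lists B"
    by auto
  ultimately show ?case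
    using Suc assms by (simp add: measure_pmf_prob_product del: replicate_pmf.simps)
qed simp

text \<open>The bit \<open>True\<close> means a crossover. Without one, \<open>x0\<close> goes to
  \<open>y0\<close> and every other letter to \<open>y1\<close>; this makes the channel total on an
  alphabet of any size.\<close>

definition bsc :: "'x \<Rightarrow> 'y \<Rightarrow> 'y \<Rightarrow> real \<Rightarrow> 'x \<Rightarrow> 'y pmf" where
  "bsc x0 y0 y1 \<eta> x =
    map_pmf (\<lambda>b. if b = (x = x0) then y1 else y0) (bernoulli_pmf \<eta>)"

lemma pmf_map_bernoulli:
  assumes "0 \<le> \<eta>" "\<eta> \<le> 1"
  shows "pmf (map_pmf f (bernoulli_pmf \<eta>)) z =
    \<eta> * indicator {z} (f True) + (1 - \<eta>) * indicator {z} (f False)"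
  using assms by (simp add: map_pmf_def pmf_bind)

lemma pmf_bsc:
  assumes "y0 \<noteq> y1" "0 \<le> \<eta>" "\<eta> \<le> 1"
  shows "pmf (bsc x0 y0 y1 \<eta> x) y =
    (if y = (if x = x0 then y0 else y1) then 1 - \<eta> else
     if y \<in> {y0, y1} then \<eta> else 0)"
  using assms by (auto simp: bsc_def pmf_map_bernoulli)

lemma pmf_of_set_two:
  assumes "x0 \<noteq> x1"
  shows "pmf (pmf_of_set {x0, x1}) x = (if x \<in> {x0, x1} then 1/2 else 0)"
  using assms by (auto simp: indicator_def)

lemma sum_two_by_two:
  fixes f :: "'x::finite \<Rightarrow> 'y::finite \<Rightarrow> real"
  assumes "x0 \<noteq> x1" "y0 \<noteq> y1" and "\<And>x y. x \<notin> {x0, x1} \<or> y \<notin> {y0, y1} \<Longrightarrow> f x y = 0"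
  shows "(\<Sum>(x, y)\<in>UNIV. f x y) = f x0 y0 + f x0 y1 + f x1 y0 + f x1 y1"
proof -
  have "(\<Sum>(x, y)\<in>UNIV. f x y) = (\<Sum>(x, y)\<in>{x0, x1} \<times> {y0, y1}. f x y)"
    using assms(3) by (intro sum.mono_neutral_right) auto
  then show ?thesis
    using assms(1,2) by (simp flip: sum.cartesian_product)
qed

text \<open>The output is uniform on two letters, so each ratio in the logarithm is twice a channel
  probability. The value is one minus the binary entropy of \<open>\<eta>\<close>.\<close>

lemma mutual_info_bsc:
  fixes x0 x1 :: "'x::finite" and y0 y1 :: "'y::finite"
  assumes "x0 \<noteq> x1" "y0 \<noteq> y1" "0 < \<eta>" "\<eta> < 1"
  shows "mutual_info (pmf_of_set {x0, x1}) (bsc x0 y0 y1 \<eta>) =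
    (1 - \<eta>) * log 2 (2 * (1 - \<eta>)) + \<eta> * log 2 (2 * \<eta>)"
proof -
  have out: "pmf (bind_pmf (pmf_of_set {x0, x1}) (bsc x0 y0 y1 \<eta>)) y = 1/2" if "y \<in> {y0, y1}" for y
    using assms that by (auto simp: pmf_bind_pmf_of_set pmf_bsc)
  then show ?thesis
    unfolding mutual_info_eq_sum using assms
    by (subst sum_two_by_two[of x0 x1 y0 y1]) (auto simp: pmf_of_set_two pmf_bsc out algebra_simps)
qed

theorem theorem1:
  fixes \<epsilon> \<delta> :: real and n :: nat
  assumes "CARD('x::finite) \<ge> 2" and "CARD('y::finite) \<ge> 2"
    and "0 < \<epsilon>" and "\<epsilon> < 1"
    and "0 < \<delta>" and "\<delta> < 1/2"
    and "n > 0"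
  shows "\<exists>(p :: 'x pmf) (w :: 'x \<Rightarrow> 'y pmf).
    mutual_info p w > \<epsilon> \<and>
    (\<forall>A. plug_in_algorithm A \<longrightarrow>
      measure_pmf.prob (replicate_pmf n (joint_pmf p w)) {s. lm_rate p w (A s) = 0} > \<delta>)"
proof -
  obtain x0 x1 :: 'x where x: "x0 \<noteq> x1"
    using assms(1) by (metis card_2_iff ex_card)
  obtain y0 y1 :: 'y where y: "y0 \<noteq> y1"
    using assms(2) by (metis card_2_iff ex_card)
  have "((\<lambda>\<eta>::real. (1 - \<eta>) * log 2 (2 * (1 - \<eta>)) + \<eta> * log 2 (2 * \<eta>)) \<longlongrightarrow> 1) (at_right 0)"
    by real_asymp
  then have "\<forall>\<^sub>F \<eta> in at_right 0. (1 - \<eta>) * log 2 (2 * (1 - \<eta>)) + \<eta> * log 2 (2 * \<eta>) > \<epsilon>"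
    using \<open>\<epsilon> < 1\<close> by (rule order_tendstoD)
  moreover have "((\<lambda>\<eta>::real. (1 - \<eta>) ^ n) \<longlongrightarrow> (1 - 0) ^ n) (at_right 0)"
    by (intro tendsto_intros)
  then have "\<forall>\<^sub>F \<eta> in at_right 0. (1 - \<eta>) ^ n > \<delta>"
    by (rule order_tendstoD) (use \<open>\<delta> < 1/2\<close> in simp)
  \<comment> \<open>Strict positivity keeps the crossover pairs in the support, where a vanishing
    metric costs \<open>-\<infinity>\<close>.\<close>
  moreover have "\<forall>\<^sub>F \<eta> in at_right 0. \<eta> \<in> {0<..<1::real}"
    by (intro eventually_at_right_real) simp
  ultimately have "\<forall>\<^sub>F \<eta> in at_right 0. \<eta> \<in> {0<..<1} \<and> (1 - \<eta>) ^ n > \<delta> \<and>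
      (1 - \<eta>) * log 2 (2 * (1 - \<eta>)) + \<eta> * log 2 (2 * \<eta>) > \<epsilon>"
    by eventually_elim simp
  then obtain \<eta> where \<eta>: "0 < \<eta>" "\<eta> < 1" "(1 - \<eta>) ^ n > \<delta>"
      "(1 - \<eta>) * log 2 (2 * (1 - \<eta>)) + \<eta> * log 2 (2 * \<eta>) > \<epsilon>"
    by (auto dest: eventually_happens simp: trivial_limit_at_right_real)
  define p where "p = pmf_of_set {x0, x1}"
  define w where "w = bsc x0 y0 y1 \<eta>"
  let ?J = "joint_pmf p w" and ?B = "{(x0, y0), (x1, y1)}"
  have J: "pmf ?J z = (if z \<in> ?B then (1 - \<eta>) / 2 else
      if z \<in> {(x0, y1), (x1, y0)} then \<eta> / 2 else 0)" for z
    using x y \<eta> by (cases z) (auto simp: pmf_joint_pmf p_def w_def pmf_of_set_two pmf_bsc)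
  have B: "measure_pmf.prob ?J ?B = 1 - \<eta>"
    using x by (simp add: measure_measure_pmf_finite J)
  have "mutual_info p w > \<epsilon>"
    using \<eta> x y by (simp add: p_def w_def mutual_info_bsc)
  moreover have "measure_pmf.prob (replicate_pmf n ?J) {s. lm_rate p w (A s) = 0} > \<delta>"
    if A: "plug_in_algorithm A" for A
  proof -
    have "lm_rate p w (A s) = 0" if s: "s \<in> set_pmf (replicate_pmf n ?J)" "set s \<subseteq> ?B" for s
    proof -
      have "s \<noteq> []" using s(1) \<open>n > 0\<close> by (auto simp: set_replicate_pmf)
      then have "hd s \<in> set s" by simp
      \<comment> \<open>The metric is only constrained in rows of observed letters, so the crossover
        pair is chosen in the row of the first sample.\<close>
      with s(2) consider "(x0, y0) \<in> set s" | "(x1, y1) \<in> set s" by fastforce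
      then show ?thesis
      proof cases
        case 1
        moreover have "(x0, y1) \<notin> set s" using s(2) x y by auto
        ultimately have "A s x0 y1 = 0" by (rule plug_in_algorithm_zero[OF A])
        then show ?thesis
          using \<eta> x y by (intro lm_rate_eq_0[of x0 y1]) (auto simp: set_pmf_iff J)
      next
        case 2
        moreover have "(x1, y0) \<notin> set s" using s(2) x y by auto
        ultimately have "A s x1 y0 = 0" by (rule plug_in_algorithm_zero[OF A])
        then show ?thesis
          using \<eta> x y by (intro lm_rate_eq_0[of x1 y0]) (auto simp: set_pmf_iff J)
      qed
    qed
    \<comment> \<open>\<open>lists ?B\<close> has lists of every length, including the empty one, so
      the inclusion is used only almost everywhere, on samples of length \<open>n\<close>.\<close>
    then have "measure_pmf.prob (replicate_pmf n ?J) (lists ?B)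
        \<le> measure_pmf.prob (replicate_pmf n ?J) {s. lm_rate p w (A s) = 0}"
      by (intro measure_pmf.finite_measure_mono_AE) (auto simp: AE_measure_pmf_iff lists_eq_set)
    then show ?thesis
      using \<eta>(3) by (simp add: prob_replicate_pmf_lists B)
  qed
  ultimately show ?thesis by blast
qed

end
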